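(* Let $r\ge 2$, $n\ge 1$, $j\ge 0$ and $k>r$ be integers. Then $$T_k(r,n,j)=F_{r+k-2}(2,r+n-2,j).$$
   Context: An $(r-1)$-tight $r$-path with $n$ edges is the $r$-uniform hypergraph on vertices $0,1,\dots,n+r-2$ with edges $E_i=\{i-1,i,\dots,i+r-2\}$ for $1\le i\le n$ (so consecutive edges share exactly $r-1$ vertices). Vertices are colored red or blue; an edge is blue if all its vertices are blue; a blue subpath of length $k$ means $k$ consecutive edges all of which are blue. $T_k(r,n,j)$ is the number of red/blue colorings of the vertices (vertices are labeled) of an $(r-1)$-tight $r$-path with $n$ edges having exactly $j$ blue vertices and no blue subpath of length $k$. $F_k(2,n,j)$ is the number of red/blue colorings of the vertices of an ordinary graph path with $n$ edges ($n+1$ vertices) having exactly $j$ blue vertices and no blue subpath with $k$ edges (i.e. no $k+1$ consecutive blue vertices). *)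

theory Defs
  imports "HOL-Library.FuncSet"
begin

datatype color = Red | Blue

(* A coloring is extensional: it takes the value undefined outside the vertex set,
   so that distinct functions are distinct colorings of the vertices. *)
definition colorings :: "nat set \<Rightarrow> (nat \<Rightarrow> color) set" where
  "colorings V = (V \<rightarrow>\<^sub>E {Red, Blue})"

definition blue_edge :: "(nat \<Rightarrow> color) \<Rightarrow> nat set \<Rightarrow> bool" where
  "blue_edge c e \<longleftrightarrow> (\<forall>v\<in>e. c v = Blue)"

(* For a path with edges E 1, ..., E n: some k consecutive edges
   E (s+1), ..., E (s+k) are all blue. *)
definition has_blue_subpath :: "(nat \<Rightarrow> nat set) \<Rightarrow> nat \<Rightarrow> nat \<Rightarrow> (nat \<Rightarrow> color) \<Rightarrow> bool" where
  "has_blue_subpath E n k c \<longleftrightarrow> (\<exists>s. s + k \<le> n \<and> (\<forall>i\<in>{s+1..s+k}. blue_edge c (E i)))"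

definition num_colorings :: "nat set \<Rightarrow> (nat \<Rightarrow> nat set) \<Rightarrow> nat \<Rightarrow> nat \<Rightarrow> nat \<Rightarrow> nat" where
  "num_colorings V E n k j =
     card {c \<in> colorings V. card {v \<in> V. c v = Blue} = j \<and> \<not> has_blue_subpath E n k c}"

(* The (r-1)-tight r-path with n edges; the truncated subtractions below are exact
   for r \<ge> 2 and i \<ge> 1. *)
definition tight_path_vertices :: "nat \<Rightarrow> nat \<Rightarrow> nat set" where
  "tight_path_vertices r n = {0..n + r - 2}"

definition tight_path_edge :: "nat \<Rightarrow> nat \<Rightarrow> nat set" where
  "tight_path_edge r i = {i - 1..i + r - 2}"

(* T k r n j is the number written T_k(r,n,j). *)
definition T :: "nat \<Rightarrow> nat \<Rightarrow> nat \<Rightarrow> nat \<Rightarrow> nat" where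
  "T k r n j = num_colorings (tight_path_vertices r n) (tight_path_edge r) n k j"

definition graph_path_vertices :: "nat \<Rightarrow> nat set" where
  "graph_path_vertices n = {0..n}"

definition graph_path_edge :: "nat \<Rightarrow> nat set" where
  "graph_path_edge i = {i - 1, i}"

(* F2 k n j is the number written F_k(2,n,j). *)
definition F2 :: "nat \<Rightarrow> nat \<Rightarrow> nat \<Rightarrow> nat" where
  "F2 k n j = num_colorings (graph_path_vertices n) graph_path_edge n k j"

end

theory Submission
  imports Defs
begin

text \<open>Consecutive edges of a tight path cover an interval of vertices, so a blue subpath with
  \<open>k\<close> edges amounts to a run of \<open>k + r - 1\<close> consecutive blue vertices. This length depends only on
  \<open>k + r\<close>, and a path with \<open>n\<close> edges has \<open>n + r - 1\<close> vertices, so both problems count the same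
  colorings.\<close>

text \<open>Lets the graph path be treated as the case \<open>r = 2\<close> of the tight
  path.\<close>

lemma graph_path_edge_eq_tight: "i \<ge> 1 \<Longrightarrow> graph_path_edge i = tight_path_edge 2 i"
  by (auto simp: graph_path_edge_def tight_path_edge_def)

lemma UN_tight_path_edge:
  assumes "r \<ge> 2" and "k \<ge> 1"
  shows "(\<Union>i\<in>{s+1..s+k}. tight_path_edge r i) = {s..s + k + r - 2}"
proof
  show "(\<Union>i\<in>{s+1..s+k}. tight_path_edge r i) \<subseteq> {s..s + k + r - 2}"
    using assms by (auto simp: tight_path_edge_def)
  show "{s..s + k + r - 2} \<subseteq> (\<Union>i\<in>{s+1..s+k}. tight_path_edge r i)"
  proof
    fix v assume v: "v \<in> {s..s + k + r - 2}"
    \<comment> \<open>Edge \<open>v + 1\<close> starts at \<open>v\<close>; for \<open>v\<close>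
      beyond the start of the last edge \<open>s + k\<close>, that edge still reaches
      \<open>v\<close>.\<close>
    define i where "i = min (v + 1) (s + k)"
    have "i \<in> {s+1..s+k}" and "v \<in> tight_path_edge r i"
      using v assms by (auto simp: i_def tight_path_edge_def min_def)
    then show "v \<in> (\<Union>i\<in>{s+1..s+k}. tight_path_edge r i)"
      by blast
  qed
qed

lemma has_blue_subpath_tight_iff:
  assumes "r \<ge> 2" and "k \<ge> 1"
  shows "has_blue_subpath (tight_path_edge r) n k c \<longleftrightarrow>
    (\<exists>s. s + k \<le> n \<and> (\<forall>v\<in>{s..s + k + r - 2}. c v = Blue))"
  \<comment> \<open>Folding the interval back into a union of edges leaves only an exchange of
    quantifiers.\<close>
  unfolding has_blue_subpath_def blue_edge_def UN_tight_path_edge[OF assms, symmetric]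
  by blast

lemma has_blue_subpath_graph_iff:
  assumes "k \<ge> 1"
  shows "has_blue_subpath graph_path_edge n k c \<longleftrightarrow>
    (\<exists>s. s + k \<le> n \<and> (\<forall>v\<in>{s..s + k}. c v = Blue))"
proof -
  have "has_blue_subpath graph_path_edge n k c \<longleftrightarrow> has_blue_subpath (tight_path_edge 2) n k c"
    by (simp add: has_blue_subpath_def graph_path_edge_eq_tight)
  then show ?thesis
    using has_blue_subpath_tight_iff[of 2 k n c] assms by simp
qed

theorem theorem4p2:
  fixes r n j k :: nat
  assumes "r \<ge> 2" and "n \<ge> 1" and "k > r"
  shows "T k r n j = F2 (r + k - 2) (r + n - 2) j"
proof -
  \<comment> \<open>The same start \<open>s\<close> serves both paths: \<open>run\<close> matches
    the last vertices of the runs, \<open>bound\<close> the admissible values of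
    \<open>s\<close>.\<close>
  have bound: "s + k + r - 2 \<le> r + n - 2 \<longleftrightarrow> s + k \<le> n" for s
    using assms by linarith
  have run: "s + (r + k - 2) = s + k + r - 2" for s
    using assms by linarith
  have "has_blue_subpath (tight_path_edge r) n k c \<longleftrightarrow>
      has_blue_subpath graph_path_edge (r + n - 2) (r + k - 2) c" for c
  proof -
    have "k \<ge> 1" and "r + k - 2 \<ge> 1"
      using assms by auto
    then show ?thesis
      using assms by (simp only: has_blue_subpath_tight_iff has_blue_subpath_graph_iff bound run)
  qed
  moreover have "tight_path_vertices r n = graph_path_vertices (r + n - 2)"
    by (simp add: tight_path_vertices_def graph_path_vertices_def add.commute)
  ultimately show ?thesis
    by (simp add: T_def F2_def num_colorings_def)
qed

end
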